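(* Let $s$ be a weak composition. The $f$-polynomial $f_s(t)=\sum_{F\in\operatorname{Perm}(s)}t^{\dim(F)}$ of the $s$-permutahedron $\operatorname{Perm}(s)$ is given by $$\sum_{T}(1+t)^{\operatorname{asc}(T)},$$ where the sum runs over all $s$-decreasing trees $T$ and $\operatorname{asc}(T)$ denotes the number of tree-ascents of $T$.
   Context: A weak composition of length $n$ is a sequence $s=(s(1),\dots,s(n))$ of non-negative integers. An $s$-decreasing tree is a rooted planar tree with $n$ internal nodes labeled bijectively by $1,\dots,n$ (leaves are unlabeled) such that node $i$ has exactly $s(i)+1$ ordered children and labels decrease from root to leaves. For a node $y$ of such a tree $T$ with $s(y)=m$, let $T^y_0,\dots,T^y_m$ be the children of $y$ from left to right, where "child" means the whole subtree; a child is empty if it is just a leaf. $T^y_0$ is the left child and $T^y_m$ the right child. A descendant of $y$ is a node lying in one of the $T^y_i$. Tree-inversions: for nodes $a<c$, $\#_T(c,a)$ is $0$ if $a$ is left of $c$ or belongs to $T^c_0$; it is $i$ if $a$ belongs to $T^c_i$ with $0<i<s(c)$; it is $s(c)$ if $a$ belongs to $T^c_{s(c)}$ or is right of $c$. $\operatorname{inv}(T)$ is the multi-set in which $(c,a)$ occurs $\#_T(c,a)$ times; it determines $T$. The $s$-weak order: $R\preccurlyeq T$ iff $\#_R(c,a)\le \#_T(c,a)$ for all $a<c$. Intervals are $[T_1,T_2]=\{R: T_1\preccurlyeq R\preccurlyeq T_2\}$. Transitive closure: for a multi-set $I$ of pairs $(c,a)$, $a<c$, with multiplicities $\#_I(c,a)$,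 a transitivity path from $c$ to $a$ is a list $c=b_1>\dots>b_k=a$, $k\ge2$, with $\#_I(b_i,b_{i+1})>0$ for all $i$; $\#_{I^{\mathsf{tc}}}(c,a)$ is the maximal value of $\#_I(b_1,b_2)$ over all such paths (and $0$ if there is none). A pair $(a,c)$ with $a<c$ is a tree-ascent of $T$ if: (i) $a$ is a descendant of $c$; (ii) $a$ does not belong to the right child of $c$; (iii) whenever $c>b>a$ and $a$ is a descendant of $b$, $a$ belongs to the right child of $b$; (iv) if $s(a)>0$, the right child of $a$ is empty. For a (possibly empty) set $A$ of tree-ascents of $T$, $T+A$ is the $s$-decreasing tree whose multi-set of tree-inversions is obtained from $\operatorname{inv}(T)$ by increasing $\#_T(c,a)$ by one for every $(a,c)\in A$ and then taking the transitive closure. A pure interval is an interval of the form $[T,T+A]$. The $s$-permutahedron $\operatorname{Perm}(s)$ is the collection of all pure intervals $[T,T+A]$ (its faces); the dimension of $[T,T+A]$ is $|A|$. *)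

theory Defs
  imports "HOL-Library.Multiset" "HOL-Computational_Algebra.Polynomial"
begin

text \<open>
  A weak composition of length \<open>n\<close> is a list of \<open>n\<close> natural numbers; its parts are indexed
  from 1, as are the nodes of the trees.
\<close>

type_synonym weak_composition = "nat list"

definition part :: "weak_composition \<Rightarrow> nat \<Rightarrow> nat" where
  "part s i = s ! (i - 1)"

datatype ptree = Leaf | Node nat "ptree list"

fun labels :: "ptree \<Rightarrow> nat list" where
  "labels Leaf = []"
| "labels (Node c ts) = c # concat (map labels ts)"

abbreviation nodes :: "ptree \<Rightarrow> nat set" where
  "nodes T \<equiv> set (labels T)"

fun subtrees :: "ptree \<Rightarrow> ptree set" where
  "subtrees Leaf = {Leaf}"
| "subtrees (Node c ts) = insert (Node c ts) (\<Union>t\<in>set ts. subtrees t)"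

definition s_decreasing_tree :: "weak_composition \<Rightarrow> ptree \<Rightarrow> bool" where
  "s_decreasing_tree s T \<longleftrightarrow>
     distinct (labels T) \<and> nodes T = {1..length s} \<and>
     (\<forall>c ts. Node c ts \<in> subtrees T \<longrightarrow>
        length ts = part s c + 1 \<and> (\<forall>t\<in>set ts. \<forall>a\<in>nodes t. a < c))"

text \<open>
  \<open>is_child T y i U\<close> says that \<open>U\<close> is the subtree \<open>T\<^sup>y\<^sub>i\<close>. It is a relation because
  \<open>y\<close> need not be a node of \<open>T\<close>; if the labels of \<open>T\<close> are distinct, then \<open>U\<close> is
  determined by \<open>T\<close>, \<open>y\<close> and \<open>i\<close>.
\<close>

definition is_child :: "ptree \<Rightarrow> nat \<Rightarrow> nat \<Rightarrow> ptree \<Rightarrow> bool" where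
  "is_child T y i U \<longleftrightarrow> (\<exists>ts. Node y ts \<in> subtrees T \<and> i < length ts \<and> U = ts ! i)"

definition in_child :: "ptree \<Rightarrow> nat \<Rightarrow> nat \<Rightarrow> nat \<Rightarrow> bool" where
  "in_child T y i a \<longleftrightarrow> (\<exists>U. is_child T y i U \<and> a \<in> nodes U)"

definition descendant :: "ptree \<Rightarrow> nat \<Rightarrow> nat \<Rightarrow> bool" where
  "descendant T y a \<longleftrightarrow> (\<exists>i. in_child T y i a)"

text \<open>\<open>left_of T a c\<close>: node \<open>a\<close> lies to the left of node \<open>c\<close>.\<close>

definition left_of :: "ptree \<Rightarrow> nat \<Rightarrow> nat \<Rightarrow> bool" where
  "left_of T a c \<longleftrightarrow> (\<exists>y i j. i < j \<and> in_child T y i a \<and> in_child T y j c)"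

text \<open>
  The number \<open>#\<^sub>T(c,a)\<close> for nodes \<open>a < c\<close>. When \<open>s(c) = 0\<close> the first two cases can
  overlap, but then both values are 0.
\<close>

definition inversion_number :: "weak_composition \<Rightarrow> ptree \<Rightarrow> nat \<Rightarrow> nat \<Rightarrow> nat" where
  "inversion_number s T c a =
     (if left_of T a c \<or> in_child T c 0 a then 0
      else if in_child T c (part s c) a \<or> left_of T c a then part s c
      else (THE i. 0 < i \<and> i < part s c \<and> in_child T c i a))"

definition tree_inversions :: "weak_composition \<Rightarrow> ptree \<Rightarrow> (nat \<times> nat) multiset" where
  "tree_inversions s T =
     (\<Sum>(c, a)\<in>{(c, a). c \<in> nodes T \<and> a \<in> nodes T \<and> a < c}.
        replicate_mset (inversion_number s T c a) (c, a))"

lemma count_tree_inversions: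
  "count (tree_inversions s T) (c, a) =
     (if c \<in> nodes T \<and> a \<in> nodes T \<and> a < c then inversion_number s T c a else 0)"
proof -
  let ?P = "{(c, a). c \<in> nodes T \<and> a \<in> nodes T \<and> a < c}"
  have fin: "finite ?P"
    by (rule finite_subset[of _ "nodes T \<times> nodes T"]) auto
  have "count (tree_inversions s T) (c, a) =
      (\<Sum>p\<in>?P. if p = (c, a) then inversion_number s T c a else 0)"
    unfolding tree_inversions_def count_sum
    by (rule sum.cong) (auto split: if_splits)
  also have "\<dots> = (if (c, a) \<in> ?P then inversion_number s T c a else 0)"
    using fin by (simp add: sum.delta')
  finally show ?thesis by simp
qed

definition s_weak_le :: "weak_composition \<Rightarrow> ptree \<Rightarrow> ptree \<Rightarrow> bool" where
  "s_weak_le s R T \<longleftrightarrow>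
     (\<forall>a c. 1 \<le> a \<and> a < c \<and> c \<le> length s \<longrightarrow>
        inversion_number s R c a \<le> inversion_number s T c a)"

definition s_weak_interval :: "weak_composition \<Rightarrow> ptree \<Rightarrow> ptree \<Rightarrow> ptree set" where
  "s_weak_interval s T1 T2 =
     {R. s_decreasing_tree s R \<and> s_weak_le s T1 R \<and> s_weak_le s R T2}"

definition transitivity_path :: "(nat \<times> nat) multiset \<Rightarrow> nat \<Rightarrow> nat \<Rightarrow> nat list \<Rightarrow> bool" where
  "transitivity_path I c a bs \<longleftrightarrow>
     2 \<le> length bs \<and> hd bs = c \<and> last bs = a \<and> sorted_wrt (>) bs \<and>
     (\<forall>i. Suc i < length bs \<longrightarrow> count I (bs ! i, bs ! Suc i) > 0)"

definition tc :: "(nat \<times> nat) multiset \<Rightarrow> (nat \<times> nat) multiset" where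
  "tc I = Abs_multiset (\<lambda>(c, a).
     Max (insert 0 {count I (bs ! 0, bs ! 1) |bs. transitivity_path I c a bs}))"

lemma count_tc:
  "count (tc I) (c, a) =
     Max (insert 0 {count I (bs ! 0, bs ! 1) |bs. transitivity_path I c a bs})"
proof -
  define f where "f = (\<lambda>(c, a).
     Max (insert 0 {count I (bs ! 0, bs ! 1) |bs. transitivity_path I c a bs}))"
  have "{x. 0 < f x} \<subseteq> (fst ` set_mset I) \<times> (snd ` set_mset I)"
  proof
    fix x assume "x \<in> {x. 0 < f x}"
    then obtain c a where x: "x = (c, a)" and pos: "0 < f (c, a)"
      by (cases x) auto
    have "\<exists>bs. transitivity_path I c a bs"
    proof (rule ccontr)
      assume "\<not> ?thesis"
      then have "f (c, a) = 0" by (simp add: f_def)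
      with pos show False by simp
    qed
    then obtain bs where bs: "2 \<le> length bs" "hd bs = c" "last bs = a"
        and cnt: "\<And>i. Suc i < length bs \<Longrightarrow> count I (bs ! i, bs ! Suc i) > 0"
      by (auto simp: transitivity_path_def)
    have "bs \<noteq> []" using bs(1) by auto
    have "(c, bs ! 1) \<in># I"
      using cnt[of 0] bs(1,2) \<open>bs \<noteq> []\<close> by (simp add: hd_conv_nth)
    then have c: "c \<in> fst ` set_mset I" by force
    have "Suc (length bs - 2) = length bs - 1" using bs(1) by simp
    then have "(bs ! (length bs - 2), a) \<in># I"
      using cnt[of "length bs - 2"] bs(1,3) \<open>bs \<noteq> []\<close> by (simp add: last_conv_nth)
    then have "a \<in> snd ` set_mset I" by force
    with c x show "x \<in> (fst ` set_mset I) \<times> (snd ` set_mset I)" by simp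
  qed
  then have "finite {x. 0 < f x}"
    by (rule finite_subset) simp
  then have "count (Abs_multiset f) = f"
    by (rule count_Abs_multiset)
  moreover have "tc I = Abs_multiset f"
    by (simp add: tc_def f_def)
  ultimately show ?thesis by (simp add: f_def)
qed

definition tree_ascents :: "weak_composition \<Rightarrow> ptree \<Rightarrow> (nat \<times> nat) set" where
  "tree_ascents s T = {(a, c).
     a < c \<and>
     descendant T c a \<and>
     \<not> in_child T c (part s c) a \<and>
     (\<forall>b. c > b \<and> b > a \<and> descendant T b a \<longrightarrow> in_child T b (part s b) a) \<and>
     (part s a > 0 \<longrightarrow> is_child T a (part s a) Leaf)}"

definition asc :: "weak_composition \<Rightarrow> ptree \<Rightarrow> nat" where
  "asc s T = card (tree_ascents s T)"

text \<open>
  The tree \<open>T + A\<close>. Ascents are pairs \<open>(a, c)\<close> and tree-inversions are pairs \<open>(c, a)\<close>,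
  hence the swap.
\<close>

definition tree_plus :: "weak_composition \<Rightarrow> ptree \<Rightarrow> (nat \<times> nat) set \<Rightarrow> ptree" where
  "tree_plus s T A = (THE T'. s_decreasing_tree s T' \<and>
     tree_inversions s T' = tc (tree_inversions s T + mset_set (prod.swap ` A)))"

definition Perm :: "weak_composition \<Rightarrow> ptree set set" where
  "Perm s = {s_weak_interval s T (tree_plus s T A) |T A.
     s_decreasing_tree s T \<and> A \<subseteq> tree_ascents s T}"

definition face_dim :: "weak_composition \<Rightarrow> ptree set \<Rightarrow> nat" where
  "face_dim s F = (THE d. \<exists>T A. s_decreasing_tree s T \<and> A \<subseteq> tree_ascents s T \<and>
     F = s_weak_interval s T (tree_plus s T A) \<and> d = card A)"

definition f_polynomial :: "weak_composition \<Rightarrow> int poly" where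
  "f_polynomial s = (\<Sum>F\<in>Perm s. monom 1 (face_dim s F))"

end

theory Submission imports Defs "HOL-Library.FuncSet" begin

text \<open>
  The faces are counted by their pairs \<open>(T, A)\<close>, with \<open>A\<close> a set of tree-ascents of \<open>T\<close>: once
  \<open>(T, A) \<mapsto> [T, T + A]\<close> is known to be injective (\<open>pure_interval_inj\<close>), the dimension of
  \<open>[T, T + A]\<close> is \<open>card A\<close>, and the subsets of the \<open>asc(T)\<close> ascents of a fixed tree contribute
  \<open>(1 + t) ^ asc(T)\<close> by the binomial theorem.

  Injectivity has two halves. The interval determines its least and greatest elements \<open>T\<close> and
  \<open>T + A\<close>, because \<open>T \<preceq> T + A\<close> and the order is antisymmetric. And \<open>T\<close> and \<open>T + A\<close> determine
  \<open>A\<close>: an ascent \<open>(a, c)\<close> of \<open>T\<close> lies in \<open>A\<close> iff the number \<open>#(c, a)\<close> is larger in \<open>T + A\<close> than in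
  \<open>T\<close> (\<open>ascent_in_iff\<close>). That is, the transitive closure never raises an ascent that is not in \<open>A\<close>
  (\<open>count_tc_ascent\<close>).

  Before that, \<open>T + A\<close> must be shown to exist. Everything is reduced to numbers: a function
  \<open>f c a\<close> on the pairs \<open>a < c\<close> of a finite label set consists of the inversion numbers of a
  decreasing tree iff it is bounded by \<open>s c\<close>, transitive and planar (\<open>inversion_function\<close>), and
  the tree is then unique (\<open>inversion_function_tree\<close>, \<open>tree_exists\<close>, \<open>tree_eqI\<close>). In a tree with
  root \<open>r\<close>, the child that contains \<open>a\<close> has index \<open>f r a\<close>, and nodes in different children are
  compared by these indices; so all three facts follow by induction on trees or on the label
  set. Descent is visible in the numbers too: \<open>a < c\<close> is a descendant of \<open>c\<close> iff
  \<open>f y a = f y c\<close> for all \<open>y > c\<close> (\<open>in_child_iff\<close>). This turns tree-ascents into a condition on \<open>f\<close>, and the remaining work is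
  combinatorics of such functions. The decisive step is that the transitive closure of
  \<open>inv(T) + A\<close> is again planar (\<open>tc_inversion_function\<close>), which rests on \<open>ascent_planar\<close>: raising
  an ascent keeps planarity with respect to every intermediate label.
\<close>

section \<open>Inversion functions and their ascents\<close>

text \<open>
  The numerical shadow of a decreasing tree with label set \<open>X\<close>: \<open>f c a\<close> plays the role of
  \<open>#(c, a)\<close>, and \<open>m c\<close> that of \<open>s(c)\<close>. Only the values at \<open>a < c\<close> in \<open>X\<close> matter.
\<close>

locale inversion_function =
  fixes X :: "nat set" and m :: "nat \<Rightarrow> nat" and f :: "nat \<Rightarrow> nat \<Rightarrow> nat"
  assumes bounded: "\<lbrakk>a \<in> X; c \<in> X; a < c\<rbrakk> \<Longrightarrow> f c a \<le> m c"
    and transitive: "\<lbrakk>a \<in> X; b \<in> X; c \<in> X; a < b; b < c\<rbrakk> \<Longrightarrow> f b a = 0 \<or> f c b \<le> f c a"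
    and planar: "\<lbrakk>a \<in> X; b \<in> X; c \<in> X; a < b; b < c\<rbrakk> \<Longrightarrow> f b a = m b \<or> f c a \<le> f c b"
begin

text \<open>
  \<open>below c a\<close>: \<open>a\<close> is a descendant of \<open>c\<close>. If \<open>a\<close> were left or right of \<open>c\<close>, the two would be
  separated by a node \<open>y > c\<close> having them in different children, so \<open>f y a \<noteq> f y c\<close>.
\<close>

definition below :: "nat \<Rightarrow> nat \<Rightarrow> bool" where
  "below c a \<longleftrightarrow> a \<in> X \<and> c \<in> X \<and> a < c \<and> (\<forall>y\<in>X. c < y \<longrightarrow> f y a = f y c)"

text \<open>
  Tree-ascents in terms of \<open>f\<close>. A descendant \<open>a\<close> of \<open>c\<close> belongs to the right child of \<open>c\<close> iff
  \<open>f c a = m c\<close>.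
\<close>

definition ascents :: "(nat \<times> nat) set" where
  "ascents = {(a, c). below c a \<and> f c a < m c \<and>
     (\<forall>b. a < b \<and> b < c \<and> below b a \<longrightarrow> f b a = m b) \<and>
     (0 < m a \<longrightarrow> (\<forall>d. below a d \<longrightarrow> f a d \<noteq> m a))}"

lemma ascentsD:
  assumes "(a, c) \<in> ascents"
  shows "below c a" "a \<in> X" "c \<in> X" "a < c" "f c a < m c"
    "\<And>y. y \<in> X \<Longrightarrow> c < y \<Longrightarrow> f y a = f y c"
    "\<And>b. \<lbrakk>a < b; b < c; below b a\<rbrakk> \<Longrightarrow> f b a = m b"
    "\<And>d. \<lbrakk>0 < m a; below a d\<rbrakk> \<Longrightarrow> f a d \<noteq> m a"
  using assms by (auto simp: ascents_def below_def)

text \<open>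
  If the largest label \<open>y\<close> with \<open>f y p \<noteq> f y q\<close> exceeds both \<open>p\<close> and \<open>q\<close>, it is a common ancestor
  of the two (their meet in the tree). The case of the larger value at \<open>q\<close> suffices by symmetry.
\<close>

lemma below_meet:
  assumes "p \<in> X" "q \<in> X" "y \<in> X" "p < y" "q < y" "f y p < f y q"
    and eq: "\<And>z. z \<in> X \<Longrightarrow> y < z \<Longrightarrow> f z p = f z q"
  shows "below y p" "below y q"
proof -
  have "f z p = f z y \<and> f z q = f z y" if "z \<in> X" "y < z" for z
  proof -
    have "f z y \<le> f z q" using transitive[of q y z] assms that by auto
    moreover have "f y p < m y" using bounded[of q y] assms by auto
    then have "f z p \<le> f z y" using planar[of p y z] assms that by auto
    ultimately show ?thesis using eq[OF that] by simp
  qed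
  then show "below y p" "below y q" using assms by (auto simp: below_def)
qed

lemma meetE:
  assumes "finite X" "a \<in> X" "b \<in> X" "a < b"
  obtains "below b a"
  | y where "y \<in> X" "b < y" "f y a \<noteq> f y b" "below y a" "below y b"
      "\<And>z. z \<in> X \<Longrightarrow> y < z \<Longrightarrow> f z a = f z b"
proof (cases "below b a")
  case False
  define Y where "Y = {y\<in>X. b < y \<and> f y a \<noteq> f y b}"
  have Y: "finite Y" "Y \<noteq> {}" using False assms by (auto simp: below_def Y_def)
  define y where "y = Max Y"
  have y: "y \<in> X" "b < y" "f y a \<noteq> f y b" using Max_in[OF Y] by (auto simp: Y_def y_def)
  have up: "f z a = f z b" if "z \<in> X" "y < z" for z
  proof (rule ccontr)
    assume "\<not> ?thesis"
    then have "z \<in> Y" using that y(2) by (simp add: Y_def)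
    then show False using Max_ge[OF Y(1), of z] that by (simp add: y_def)
  qed
  have ay: "a < y" using y assms by simp
  have "below y a \<and> below y b"
  proof (cases "f y a < f y b")
    case True
    then show ?thesis using below_meet[of a b y] y(1,2) ay assms(2,3) up by simp
  next
    case False
    then have "f y b < f y a" using y(3) by simp
    then show ?thesis using below_meet[of b a y] y(1,2) ay assms(2,3) up by simp
  qed
  then show ?thesis using that(2) y up by simp
qed (use that in blast)

text \<open>
  Planarity survives raising \<open>f x z\<close> by one at an ascent \<open>(z, x)\<close>.
\<close>

lemma ascent_planar:
  assumes fin: "finite X" and asc: "(z, x) \<in> ascents" and b: "b \<in> X" "z < b" "b < x"
  shows "f b z = m b \<or> f x z < f x b"
proof (rule ccontr)
  assume contra: "\<not> ?thesis"
  note D = ascentsD[OF asc]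
  \<comment> \<open>Planarity of \<open>f\<close> leaves only the boundary case, where \<open>f x b\<close> is one too small.\<close>
  have eq: "f x b = f x z" using planar[of z b x] contra D b by auto
  show False
    using fin D(2) b(1,2)
  proof (cases rule: meetE)
    case 1
    then show False using D(7)[of b] b contra by blast
  next
    case (2 y)
    have less: "f y z < f y b"
      using planar[of z b y] 2 contra b D(2) by auto
    consider "y < x" | "y = x" | "x < y" by linarith
    then show False
    proof cases
      case 1
      \<comment> \<open>\<open>z\<close> lies in the right child of \<open>y\<close>, so \<open>b\<close> cannot be further right.\<close>
      then have "f y z = m y" using D(7)[of y] 2 b by auto
      then show False using bounded[of b y] less 2 b by auto
    next
      case 2
      then show False using eq less by auto
    next
      case 3
      \<comment> \<open>\<open>x\<close> is left of \<open>b\<close>, hence \<open>f x b\<close> is maximal, whereas \<open>f x z < m x\<close>.\<close>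
      then have "f y x < f y b" using less D(6) 2 by auto
      then have "f x b = m x" using planar[of b x y] 3 2 b D by auto
      then show False using eq D(5) by auto
    qed
  qed
qed

end

section \<open>Transitive closure by reachability\<close>

text \<open>
  A multiset \<open>I\<close> of pairs is read as the relation \<open>set_mset I\<close>, so that a transitivity path from
  \<open>c\<close> to \<open>a\<close> is a first edge \<open>(c, b)\<close> followed by an element \<open>(b, a)\<close> of the reflexive
  transitive closure of that relation. As the edges decrease, so does the whole path.
\<close>

lemma reach_le:
  fixes I :: "(nat \<times> nat) multiset"
  assumes dec: "\<And>x y. (x, y) \<in># I \<Longrightarrow> y < x" and "(b, a) \<in> (set_mset I)\<^sup>*"
  shows "a \<le> b"
  using assms(2)
proof induction
  case (step y z)
  then show ?case using dec[of y z] by linarith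
qed simp

lemma reach_imp_path:
  assumes dec: "\<And>x y. (x, y) \<in># I \<Longrightarrow> y < x"
    and "(b, a) \<in> (set_mset I)\<^sup>*" "(c, b) \<in># I"
  shows "\<exists>bs. transitivity_path I c a (c # b # bs)"
  using assms(2,3)
proof (induction arbitrary: c rule: converse_rtrancl_induct)
  case base
  then have "transitivity_path I c a [c, a]"
    using dec by (auto simp: transitivity_path_def)
  then show ?case by blast
next
  case (step b b')
  then obtain bs where bs: "transitivity_path I b a (b # b' # bs)"
    by auto
  have "transitivity_path I c a (c # b # b' # bs)"
    using bs dec[OF step.prems] step.prems
    by (fastforce simp: transitivity_path_def nth_Cons split: nat.split)
  then show ?case by blast
qed

lemma path_imp_reach:
  assumes "transitivity_path I c a bs"
  shows "(c, bs ! 1) \<in># I \<and> (bs ! 1, a) \<in> (set_mset I)\<^sup>* \<and> bs ! 0 = c"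
proof -
  have len: "2 \<le> length bs" "hd bs = c" "last bs = a"
    and st: "\<And>i. Suc i < length bs \<Longrightarrow> (bs ! i, bs ! Suc i) \<in># I"
    using assms by (auto simp: transitivity_path_def)
  have ne: "bs \<noteq> []" using len by auto
  have c: "bs ! 0 = c" using len ne by (simp add: hd_conv_nth)
  have "(bs ! 1, bs ! Suc i) \<in> (set_mset I)\<^sup>*" if "Suc i < length bs" for i
    using that
  proof (induction i)
    case (Suc i)
    then show ?case using st[of "Suc i"] by (auto intro: rtrancl_into_rtrancl)
  qed simp
  from this[of "length bs - 2"] have "(bs ! 1, a) \<in> (set_mset I)\<^sup>*"
    using len ne by (simp add: last_conv_nth numeral_2_eq_2 Suc_diff_Suc)
  then show ?thesis using st[of 0] len c by auto
qed

lemma le_count_tc_iff: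
  assumes dec: "\<And>x y. (x, y) \<in># I \<Longrightarrow> y < x"
  shows "k \<le> count (tc I) (c, a) \<longleftrightarrow>
    k = 0 \<or> (\<exists>b. k \<le> count I (c, b) \<and> (b, a) \<in> (set_mset I)\<^sup>*)"
proof -
  let ?S = "{count I (bs ! 0, bs ! 1) |bs. transitivity_path I c a bs}"
  have S: "?S = {count I (c, b) |b. (c, b) \<in># I \<and> (b, a) \<in> (set_mset I)\<^sup>*}" (is "_ = ?S'")
  proof
    show "?S \<subseteq> ?S'"
    proof
      fix x assume "x \<in> ?S"
      then obtain bs where "x = count I (bs ! 0, bs ! 1)" "transitivity_path I c a bs" by blast
      then show "x \<in> ?S'" using path_imp_reach[of I c a bs] by auto
    qed
    show "?S' \<subseteq> ?S"
    proof
      fix x assume "x \<in> ?S'"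
      then obtain b where b: "x = count I (c, b)" "(c, b) \<in># I" "(b, a) \<in> (set_mset I)\<^sup>*"
        by blast
      then obtain bs where "transitivity_path I c a (c # b # bs)"
        using reach_imp_path[OF dec] by metis
      then show "x \<in> ?S" using b(1) by force
    qed
  qed
  have "?S' \<subseteq> count I ` set_mset I" by blast
  then have fin: "finite ?S'" by (rule finite_subset) simp
  have "k \<le> count (tc I) (c, a) \<longleftrightarrow>
      k = 0 \<or> (\<exists>b. k \<le> count I (c, b) \<and> (c, b) \<in># I \<and> (b, a) \<in> (set_mset I)\<^sup>*)"
    unfolding count_tc S using fin by (subst Max_ge_iff) auto
  moreover have "(c, b) \<in># I" if "k \<le> count I (c, b)" "k \<noteq> 0" for b
    using that by (metis count_eq_zero_iff le_zero_eq)
  ultimately show ?thesis by blast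
qed

section \<open>Raising a set of ascents\<close>

text \<open>
  An inversion function \<open>f\<close> whose values at a set \<open>A\<close> of ascents are raised by one; \<open>I\<close> is the
  resulting multiset of inversions. The pairs in \<open>A\<close> are \<open>(a, c)\<close>, those in \<open>I\<close> are \<open>(c, a)\<close>,
  with \<open>a < c\<close>.
\<close>

locale raised_inversion_function = inversion_function +
  fixes A :: "(nat \<times> nat) set" and I :: "(nat \<times> nat) multiset"
  assumes fin: "finite X" and A: "A \<subseteq> ascents"
    and count_I: "count I (c, a) =
      (if a \<in> X \<and> c \<in> X \<and> a < c then f c a + of_bool ((a, c) \<in> A) else 0)"
begin

lemma count_I_posD:
  assumes "(c, a) \<in># I"
  shows "a \<in> X" "c \<in> X" "a < c" "0 < f c a \<or> (a, c) \<in> A"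
  using assms[folded count_greater_zero_iff] by (auto simp: count_I split: if_splits)

lemma reach_below: "(b, a) \<in> (set_mset I)\<^sup>* \<Longrightarrow> a \<le> b"
  using reach_le count_I_posD(3) by blast

lemma le_count_tc:
  "k \<le> count (tc I) (c, a) \<longleftrightarrow>
    k = 0 \<or> (\<exists>b. k \<le> count I (c, b) \<and> (b, a) \<in> (set_mset I)\<^sup>*)"
  by (rule le_count_tc_iff) (rule count_I_posD(3))

lemma f_le_count_I: "\<lbrakk>a \<in> X; c \<in> X; a < c\<rbrakk> \<Longrightarrow> f c a \<le> count I (c, a)"
  by (simp add: count_I)

lemma count_I_le: "count I (c, a) \<le> m c"
proof (cases "a \<in> X \<and> c \<in> X \<and> a < c")
  case True
  moreover have "f c a < m c" if "(a, c) \<in> A" using that A ascentsD(5) by blast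
  ultimately show ?thesis using bounded[of a c] by (auto simp: count_I)
next
  case False
  then show ?thesis by (subst count_I) auto
qed

lemma count_I_le_count_tc: "count I (c, a) \<le> count (tc I) (c, a)"
  by (auto simp: le_count_tc)

lemma count_tc_le: "count (tc I) (c, a) \<le> m c"
proof -
  have "count (tc I) (c, a) = 0 \<or> (\<exists>b. count (tc I) (c, a) \<le> count I (c, b))"
    using le_count_tc[of "count (tc I) (c, a)" c a] by blast
  then show ?thesis using count_I_le by (metis le0 le_trans)
qed

lemma count_tc_outside:
  assumes "\<not> (a \<in> X \<and> c \<in> X \<and> a < c)"
  shows "count (tc I) (c, a) = 0"
proof (rule ccontr)
  assume "\<not> ?thesis"
  then have "1 \<le> count (tc I) (c, a)" by simp
  then obtain b where b: "(c, b) \<in># I" "(b, a) \<in> (set_mset I)\<^sup>*"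
    unfolding le_count_tc by (auto simp: Suc_le_eq)
  have "a \<in> X" using b(2,1)
    by (cases rule: rtranclE) (auto dest: count_I_posD)
  then show False using b count_I_posD[OF b(1)] reach_below[OF b(2)] assms by auto
qed

lemma count_I_planar:
  assumes "(x, z) \<in># I" "z < b" "b < x" "b \<in> X"
  shows "f b z = m b \<or> count I (x, z) \<le> f x b"
  using ascent_planar[OF fin, of z x b] planar[of z b x] count_I_posD[OF assms(1)] A assms
  by (auto simp: count_I)

text \<open>
  Let a path from \<open>x\<close> to \<open>a\<close> jump over the label \<open>b\<close> by the edge \<open>(y, z)\<close>. By \<open>count_I_planar\<close>
  either \<open>(y, b)\<close> is an edge too, so that \<open>b\<close> can be reached from \<open>x\<close>, or \<open>(b, z)\<close> has the maximal
  multiplicity, which the rest of the path carries over to \<open>(b, a)\<close>.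
\<close>

lemma reach_planar:
  assumes "(x, a) \<in> (set_mset I)\<^sup>*" "a < b" "b < x" "b \<in> X"
  shows "(x, b) \<in> (set_mset I)\<^sup>* \<or> count (tc I) (b, a) = m b"
  using assms
proof (induction rule: converse_rtrancl_induct)
  case (step x z)
  have pos: "(x, z) \<in># I" using step by auto
  consider "z = b" | "b < z" | "z < b" by linarith
  then show ?case
  proof cases
    case 3
    from count_I_planar[OF pos 3 step(5,6)] show ?thesis
    proof
      assume "count I (x, z) \<le> f x b"
      also have "\<dots> \<le> count I (x, b)" using f_le_count_I step count_I_posD[OF pos] by auto
      finally have "(x, b) \<in># I"
        using pos by (metis count_greater_zero_iff less_le_trans)
      then show ?thesis by auto
    next
      assume "f b z = m b"
      then have "m b \<le> count I (b, z)" using f_le_count_I[of z b] step 3 count_I_posD[OF pos] by auto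
      then have "m b \<le> count (tc I) (b, a)" using step(2) by (auto simp: le_count_tc)
      then show ?thesis using count_tc_le[of b a] by auto
    qed
  qed (use step in \<open>auto intro: converse_rtrancl_into_rtrancl\<close>)
qed auto

lemma tc_inversion_function: "inversion_function X m (\<lambda>c a. count (tc I) (c, a))"
proof
  fix a c show "count (tc I) (c, a) \<le> m c" by (rule count_tc_le)
next
  fix a b c assume *: "a \<in> X" "b \<in> X" "c \<in> X" "a < b" "b < c"
  show "count (tc I) (b, a) = 0 \<or> count (tc I) (c, b) \<le> count (tc I) (c, a)"
  proof (cases "count (tc I) (b, a) = 0")
    case False
    then have "1 \<le> count (tc I) (b, a)" by simp
    then obtain d where d: "(b, d) \<in># I" "(d, a) \<in> (set_mset I)\<^sup>*"
      unfolding le_count_tc by (auto simp: Suc_le_eq)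
    then have "(b, a) \<in> (set_mset I)\<^sup>*"
      by (auto intro: converse_rtrancl_into_rtrancl)
    then show ?thesis
      using le_count_tc[of "count (tc I) (c, b)" c b] le_count_tc[of "count (tc I) (c, b)" c a]
      by (auto intro: rtrancl_trans)
  qed simp
next
  fix a b c assume *: "a \<in> X" "b \<in> X" "c \<in> X" "a < b" "b < c"
  let ?i = "count (tc I) (c, a)"
  show "count (tc I) (b, a) = m b \<or> ?i \<le> count (tc I) (c, b)"
  proof (cases "?i = 0")
    case False
    then obtain d where d: "?i \<le> count I (c, d)" "(d, a) \<in> (set_mset I)\<^sup>*"
      using le_count_tc[of ?i c a] by (metis order_refl)
    then have cd: "(c, d) \<in># I" using False by (metis count_eq_zero_iff le_zero_eq)
    consider "d = b" | "b < d" | "d < b" by linarith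
    then show ?thesis
    proof cases
      case 1
      then show ?thesis using d by (auto simp: le_count_tc)
    next
      case 2
      then show ?thesis using reach_planar[OF d(2) *(4) 2 *(2)] d(1)
        by (auto simp: le_count_tc)
    next
      case 3
      from count_I_planar[OF cd 3 *(5,2)] show ?thesis
      proof
        assume "count I (c, d) \<le> f c b"
        also have "\<dots> \<le> count I (c, b)" using f_le_count_I * by auto
        also have "\<dots> \<le> count (tc I) (c, b)" by (rule count_I_le_count_tc)
        finally show ?thesis using d(1) by auto
      next
        assume "f b d = m b"
        then have "m b \<le> count I (b, d)"
          using f_le_count_I[of d b] * 3 count_I_posD[OF cd] by auto
        then have "m b \<le> count (tc I) (b, a)" using d(2) by (auto simp: le_count_tc)
        then show ?thesis using count_tc_le[of b a] by auto
      qed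
    qed
  qed simp
qed

text \<open>
  No path leads from \<open>y\<close> to a node left of \<open>y\<close>.
\<close>

lemma reach_mono:
  assumes "(y, a) \<in> (set_mset I)\<^sup>*" "y < w" "w \<in> X"
  shows "f w y \<le> f w a"
  using assms
proof (induction rule: converse_rtrancl_induct)
  case (step y z)
  have pos: "(y, z) \<in># I" using step by auto
  note D = count_I_posD[OF pos]
  have "f w y \<le> f w z"
    using D(4)
  proof
    assume "0 < f y z"
    then show ?thesis using transitive[of z y w] D step by auto
  next
    assume "(z, y) \<in> A"
    then show ?thesis using ascentsD(6)[of z y w] A step by auto
  qed
  also have "\<dots> \<le> f w a" using step D by auto
  finally show ?case .
qed simp

text \<open>
  By \<open>reach_mono\<close>, a path that gives \<open>(c, a)\<close> more than \<open>f c a\<close> must begin with a raised ascent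
  \<open>(y, c)\<close>, with \<open>y\<close> in the same child of \<open>c\<close> as \<open>a\<close>, and \<open>a\<close> is not left of \<open>y\<close>. The ascent
  conditions exclude the other positions of \<open>a\<close>.
\<close>

lemma count_tc_ascent:
  assumes asc: "(a, c) \<in> ascents" and nA: "(a, c) \<notin> A"
  shows "count (tc I) (c, a) \<le> f c a"
proof (rule ccontr)
  assume "\<not> ?thesis"
  then have "f c a + 1 \<le> count (tc I) (c, a)" by simp
  then obtain y where y: "f c a < count I (c, y)" "(y, a) \<in> (set_mset I)\<^sup>*"
    using le_count_tc[of "f c a + 1" c a] by (auto simp: Suc_le_eq)
  note D = ascentsD[OF asc]
  have "(c, y) \<in># I" using y(1) by (metis count_greater_zero_iff gr_zeroI not_less0)
  then have yX: "y \<in> X" "y < c" using count_I_posD by blast+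
  have ne: "y \<noteq> a" using y nA D by (auto simp: count_I)
  then have ay: "a < y" using reach_below[OF y(2)] by auto
  have le: "f c y \<le> f c a" using reach_mono[OF y(2) yX(2) D(3)] .
  then have yA: "(y, c) \<in> A" and eq: "f c y = f c a"
    using y(1) by (auto simp: count_I of_bool_def split: if_splits)
  then have yasc: "(y, c) \<in> ascents" using A by auto
  note E = ascentsD[OF yasc]
  from y(2) ne obtain z where "(y, z) \<in># I" by (auto elim: converse_rtranclE)
  then have my: "0 < m y" using count_I_le[of y z] by (metis count_eq_zero_iff gr_zeroI le_zero_eq)
  show False
    using fin D(2) yX(1) ay
  proof (cases rule: meetE)
    case 1
    \<comment> \<open>As \<open>(a, c)\<close> is an ascent, \<open>a\<close> lies in the right child of \<open>y\<close>, which is empty as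
      \<open>(y, c)\<close> is an ascent.\<close>
    then show False using D(7)[of y] E(8)[of a] ay yX my by auto
  next
    case (2 w)
    have less: "f w y < f w a" using reach_mono[OF y(2) 2(2,1)] 2(3) by auto
    consider "w < c" | "w = c" | "c < w" by linarith
    then show False
    proof cases
      case 1
      \<comment> \<open>\<open>y\<close> lies in the right child of \<open>w\<close>, so \<open>a\<close> cannot be further right.\<close>
      then have "f w y = m w" using E(7)[of w] 2 by auto
      then show False using bounded[of a w] less 2 ay D by auto
    next
      case 2
      then show False using eq less by auto
    next
      case 3
      then show False using D(6)[of w] E(6)[of w] 2 by auto
    qed
  qed
qed

end

section \<open>Recursive structure of decreasing trees\<close>

text \<open>
  Decreasing trees with an arbitrary label set, so that the children of such a tree are such
  trees again.
\<close>

definition decreasing :: "weak_composition \<Rightarrow> ptree \<Rightarrow> bool" where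
  "decreasing s T \<longleftrightarrow> distinct (labels T) \<and>
     (\<forall>c ts. Node c ts \<in> subtrees T \<longrightarrow>
        length ts = part s c + 1 \<and> (\<forall>t\<in>set ts. \<forall>a\<in>nodes t. a < c))"

lemma s_decreasing_tree_iff: "s_decreasing_tree s T \<longleftrightarrow> decreasing s T \<and> nodes T = {1..length s}"
  by (auto simp: s_decreasing_tree_def decreasing_def)

lemma decreasing_Leaf: "decreasing s Leaf"
  by (simp add: decreasing_def)

lemma nodes_Node: "a \<in> nodes (Node c ts) \<longleftrightarrow> a = c \<or> (\<exists>i<length ts. a \<in> nodes (ts ! i))"
  by (simp, metis in_set_conv_nth)

lemma distinct_concat_nth:
  "distinct (concat xss) \<longleftrightarrow> (\<forall>xs\<in>set xss. distinct xs) \<and>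
     (\<forall>i<length xss. \<forall>j<length xss. \<forall>a. a \<in> set (xss ! i) \<longrightarrow> a \<in> set (xss ! j) \<longrightarrow> i = j)"
proof (induction xss)
  case (Cons xs xss)
  have "(\<forall>i<length (xs # xss). \<forall>j<length (xs # xss). \<forall>a.
          a \<in> set ((xs # xss) ! i) \<longrightarrow> a \<in> set ((xs # xss) ! j) \<longrightarrow> i = j) \<longleftrightarrow>
        (\<forall>i<length xss. \<forall>j<length xss. \<forall>a. a \<in> set (xss ! i) \<longrightarrow> a \<in> set (xss ! j) \<longrightarrow> i = j) \<and>
        (\<forall>i<length xss. \<forall>a. a \<in> set xs \<longrightarrow> a \<notin> set (xss ! i))"
    unfolding length_Cons All_less_Suc2 by (simp, blast)
  moreover have "set xs \<inter> \<Union> (set ` set xss) = {} \<longleftrightarrow>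
        (\<forall>i<length xss. \<forall>a. a \<in> set xs \<longrightarrow> a \<notin> set (xss ! i))"
    unfolding disjoint_iff UN_iff by (metis in_set_conv_nth)
  ultimately show ?case
    using Cons.IH by (simp only: concat.simps distinct_append set_concat list.set) auto
qed simp

lemma decreasing_Node:
  "decreasing s (Node c ts) \<longleftrightarrow> length ts = part s c + 1 \<and>
     (\<forall>t\<in>set ts. decreasing s t \<and> (\<forall>a\<in>nodes t. a < c)) \<and>
     (\<forall>i<length ts. \<forall>j<length ts. \<forall>a. a \<in> nodes (ts ! i) \<longrightarrow> a \<in> nodes (ts ! j) \<longrightarrow> i = j)"
proof -
  have sub: "(\<forall>y us. Node y us \<in> subtrees (Node c ts) \<longrightarrow> Q y us) \<longleftrightarrow>
      Q c ts \<and> (\<forall>t\<in>set ts. \<forall>y us. Node y us \<in> subtrees t \<longrightarrow> Q y us)" for Q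
    by auto
  have "distinct (concat (map labels ts)) \<longleftrightarrow> (\<forall>t\<in>set ts. distinct (labels t)) \<and>
      (\<forall>i<length ts. \<forall>j<length ts. \<forall>a. a \<in> nodes (ts ! i) \<longrightarrow> a \<in> nodes (ts ! j) \<longrightarrow> i = j)"
    using distinct_concat_nth[of "map labels ts"] by simp
  moreover have "c \<notin> set (concat (map labels ts))" if "\<forall>t\<in>set ts. \<forall>a\<in>nodes t. a < c"
    using that by auto
  ultimately show ?thesis
    unfolding decreasing_def sub labels.simps distinct.simps by blast
qed

lemma subtrees_nodes:
  "Node y us \<in> subtrees T \<Longrightarrow> y \<in> nodes T \<and> (\<forall>u\<in>set us. nodes u \<subseteq> nodes T)"
  by (induction T) auto

lemma in_child_nodes: "in_child T y i a \<Longrightarrow> y \<in> nodes T \<and> a \<in> nodes T"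
  unfolding in_child_def is_child_def using subtrees_nodes[of y _ T] by fastforce

lemma in_child_subtrees:
  "in_child T y i a \<longleftrightarrow> (\<exists>us. Node y us \<in> subtrees T \<and> i < length us \<and> a \<in> nodes (us ! i))"
  unfolding in_child_def is_child_def by auto

lemma in_child_Node:
  "in_child (Node c ts) y i a \<longleftrightarrow>
     (y = c \<and> i < length ts \<and> a \<in> nodes (ts ! i)) \<or> (\<exists>k<length ts. in_child (ts ! k) y i a)"
proof -
  have sub: "Node y us \<in> subtrees (Node c ts) \<longleftrightarrow>
      (y = c \<and> us = ts) \<or> (\<exists>k<length ts. Node y us \<in> subtrees (ts ! k))" for us
    by (simp, metis in_set_conv_nth)
  show ?thesis unfolding in_child_subtrees sub by blast
qed

context
  fixes s :: weak_composition and c :: nat and ts :: "ptree list"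
  assumes dec: "decreasing s (Node c ts)"
begin

lemma length_children: "length ts = part s c + 1"
  and child_decreasing: "i < length ts \<Longrightarrow> decreasing s (ts ! i)"
  and child_less: "i < length ts \<Longrightarrow> a \<in> nodes (ts ! i) \<Longrightarrow> a < c"
  and child_unique: "\<lbrakk>i < length ts; j < length ts; a \<in> nodes (ts ! i); a \<in> nodes (ts ! j)\<rbrakk> \<Longrightarrow> i = j"
  using dec by (auto simp: decreasing_Node)

lemma in_child_child:
  assumes "i < length ts" "b \<in> nodes (ts ! i)"
  shows "in_child (Node c ts) b k a \<longleftrightarrow> in_child (ts ! i) b k a"
proof
  assume "in_child (Node c ts) b k a"
  then obtain j where j: "j < length ts" "in_child (ts ! j) b k a"
    using child_less[OF assms] by (auto simp: in_child_Node)
  then show "in_child (ts ! i) b k a"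
    using child_unique[of j i b] assms in_child_nodes by blast
qed (use assms in \<open>auto simp: in_child_Node\<close>)

lemma in_child_root: "in_child (Node c ts) c k a \<longleftrightarrow> k < length ts \<and> a \<in> nodes (ts ! k)"
proof -
  have "\<not> in_child (ts ! i) c k a" if "i < length ts" for i
    using in_child_nodes[of "ts ! i" c k a] child_less[OF that] by blast
  then show ?thesis by (auto simp: in_child_Node)
qed

lemma left_of_root: "\<not> left_of (Node c ts) a c" "\<not> left_of (Node c ts) c a"
proof -
  have "\<not> in_child (Node c ts) y i c" for y i
    using in_child_nodes child_less unfolding in_child_Node by blast
  then show "\<not> left_of (Node c ts) a c" "\<not> left_of (Node c ts) c a"
    by (auto simp: left_of_def)
qed

lemma left_of_children:
  assumes "i < length ts" "j < length ts" "a \<in> nodes (ts ! i)" "b \<in> nodes (ts ! j)"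
  shows "left_of (Node c ts) a b \<longleftrightarrow> i < j \<or> (i = j \<and> left_of (ts ! i) a b)"
proof
  assume "left_of (Node c ts) a b"
  then obtain y k l where y: "k < l" "in_child (Node c ts) y k a" "in_child (Node c ts) y l b"
    by (auto simp: left_of_def)
  show "i < j \<or> (i = j \<and> left_of (ts ! i) a b)"
  proof (cases "y = c")
    case True
    then have "k = i \<and> l = j"
      using y(2,3) child_unique assms unfolding True in_child_root by blast
    then show ?thesis using y by simp
  next
    case False
    then obtain p where p: "p < length ts" "in_child (ts ! p) y k a"
      using y(2) by (auto simp: in_child_Node)
    then have "y \<in> nodes (ts ! p)" using in_child_nodes by blast
    then have q: "in_child (ts ! p) y l b" using y(3) p in_child_child by blast
    have "p = i" "p = j" using child_unique p q assms in_child_nodes by blast+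
    then show ?thesis using p q y(1) by (auto simp: left_of_def)
  qed
next
  assume "i < j \<or> (i = j \<and> left_of (ts ! i) a b)"
  then show "left_of (Node c ts) a b"
  proof
    assume "i < j"
    then show ?thesis using assms unfolding left_of_def by (metis in_child_root)
  next
    assume "i = j \<and> left_of (ts ! i) a b"
    then show ?thesis using assms nth_mem unfolding left_of_def in_child_Node by blast
  qed
qed

lemma inversion_number_root:
  assumes "i < length ts" "a \<in> nodes (ts ! i)"
  shows "inversion_number s (Node c ts) c a = i"
proof -
  have "in_child (Node c ts) c k a \<longleftrightarrow> k = i" for k
    using assms child_unique by (auto simp: in_child_root)
  moreover have "i \<le> part s c" using assms length_children by simp
  moreover have "(THE k. 0 < k \<and> k < part s c \<and> k = i) = i" if "0 < i" "i < part s c"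
    using that by (intro the_equality) auto
  ultimately show ?thesis
    by (auto simp: inversion_number_def left_of_root)
qed

lemma inversion_number_children:
  assumes "i < length ts" "j < length ts" "a \<in> nodes (ts ! i)" "b \<in> nodes (ts ! j)"
  shows "inversion_number s (Node c ts) b a =
    (if i < j then 0 else if j < i then part s b else inversion_number s (ts ! j) b a)"
proof (cases "i = j")
  case True
  then show ?thesis using assms
    by (simp add: inversion_number_def left_of_children[of j j] in_child_child[of j b])
next
  case False
  then have "\<not> in_child (Node c ts) b k a" for k
    using assms child_unique[of i j a] in_child_nodes[of "ts ! j" b k a]
    by (auto simp: in_child_child[of j b])
  then show ?thesis using assms False
    by (simp add: inversion_number_def left_of_children[of i j a b] left_of_children[of j i b a])
qed

end

lemma node_cases:
  assumes "decreasing s (Node c ts)" "a \<in> nodes (Node c ts)"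
  obtains (root) "a = c" | (child) i where "i < length ts" "a \<in> nodes (ts ! i)" "a < c"
  using assms child_less unfolding nodes_Node by blast

lemma in_some_child:
  assumes "decreasing s (Node r ts)"
    and "a \<in> nodes (Node r ts)" "c \<in> nodes (Node r ts)" "a < c"
  obtains i where "i < length ts" "a \<in> nodes (ts ! i)"
  using assms(2,3,4) by (metis node_cases[OF assms(1)] less_asym)

section \<open>Trees and inversion functions\<close>

lemma inversion_function_tree:
  assumes "decreasing s T"
  shows "inversion_function (nodes T) (part s) (inversion_number s T)"
  using assms
proof (induction T)
  case Leaf
  show ?case by unfold_locales simp_all
next
  case (Node r ts)
  note dec = Node.prems
  note at_root = inversion_number_root[OF dec]
  note children = inversion_number_children[OF dec]
  have IH: "inversion_function (nodes (ts ! i)) (part s) (inversion_number s (ts ! i))"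
    if "i < length ts" for i
    using Node.IH[of "ts ! i"] child_decreasing[OF dec] that by simp
  show ?case
  proof
    fix a c assume ac: "a \<in> nodes (Node r ts)" "c \<in> nodes (Node r ts)" "a < c"
    show "inversion_number s (Node r ts) c a \<le> part s c"
      using dec ac(2)
    proof (cases rule: node_cases)
      case root
      then obtain i where "i < length ts" "a \<in> nodes (ts ! i)"
        using in_some_child[OF dec ac] by blast
      then show ?thesis using root at_root[of i a] length_children[OF dec] by simp
    next
      case (child j)
      then obtain i where i: "i < length ts" "a \<in> nodes (ts ! i)"
        using in_some_child[OF dec ac] by blast
      then show ?thesis using children[of i j a c] child ac(3)
          inversion_function.bounded[OF IH, of j a c] by auto
    qed
  next
    fix a b c
    assume abc: "a \<in> nodes (Node r ts)" "b \<in> nodes (Node r ts)" "c \<in> nodes (Node r ts)" "a < b" "b < c"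
    obtain i j where ij: "i < length ts" "a \<in> nodes (ts ! i)" "j < length ts" "b \<in> nodes (ts ! j)"
      using in_some_child[OF dec] abc by metis
    have "(inversion_number s (Node r ts) b a = 0 \<or>
           inversion_number s (Node r ts) c b \<le> inversion_number s (Node r ts) c a) \<and>
          (inversion_number s (Node r ts) b a = part s b \<or>
           inversion_number s (Node r ts) c a \<le> inversion_number s (Node r ts) c b)"
      using dec abc(3)
    proof (cases rule: node_cases)
      case root
      then show ?thesis using ij root at_root children[of i j a b] by auto
    next
      case (child k)
      show ?thesis
        using children[of i j a b] children[of i k a c] children[of j k b c] ij child abc(4,5)
          inversion_function.bounded[OF IH, of k a c] inversion_function.bounded[OF IH, of k b c]
          inversion_function.transitive[OF IH, of k a b c] inversion_function.planar[OF IH, of k a b c]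
        by (auto split: if_splits)
    qed
    then show "inversion_number s (Node r ts) b a = 0 \<or>
           inversion_number s (Node r ts) c b \<le> inversion_number s (Node r ts) c a"
      "inversion_number s (Node r ts) b a = part s b \<or>
           inversion_number s (Node r ts) c a \<le> inversion_number s (Node r ts) c b"
      by auto
  qed
qed

text \<open>
  The child of \<open>c\<close> that contains \<open>a\<close> can be read off from the inversion numbers: no node above \<open>c\<close>
  separates \<open>a\<close> from \<open>c\<close>, and \<open>#(c, a)\<close> is its index.
\<close>

lemma in_child_iff:
  assumes "decreasing s T"
  shows "in_child T c i a \<longleftrightarrow>
    inversion_function.below (nodes T) (inversion_number s T) c a \<and> inversion_number s T c a = i"
  unfolding inversion_function.below_def[OF inversion_function_tree[OF assms]]
  using assms
proof (induction T)
  case Leaf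
  show ?case by (simp add: in_child_def is_child_def)
next
  case (Node r ts)
  note dec = Node.prems
  note at_root = inversion_number_root[OF dec]
  note children = inversion_number_children[OF dec]
  let ?T = "Node r ts" and ?v = "inversion_number s (Node r ts)"
  show ?case
  proof (cases "c \<in> nodes ?T")
    case False
    then show ?thesis using in_child_nodes by blast
  next
    case True
    show ?thesis
      using dec True
    proof (cases rule: node_cases)
      case root
      have "in_child ?T r i a \<longleftrightarrow> (\<exists>k<length ts. a \<in> nodes (ts ! k) \<and> k = i)"
        by (auto simp: in_child_root[OF dec])
      also have "\<dots> \<longleftrightarrow> a \<in> nodes ?T \<and> a < r \<and> ?v r a = i"
        using at_root child_less[OF dec] unfolding nodes_Node by blast
      also have "\<dots> \<longleftrightarrow> (a \<in> nodes ?T \<and> r \<in> nodes ?T \<and> a < r \<and> (\<forall>y\<in>nodes ?T. r < y \<longrightarrow> ?v y a = ?v y r)) \<and> ?v r a = i"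
      proof -
        have "\<not> r < y" if "y \<in> nodes ?T" for y
          using node_cases[OF dec that] by force
        then show ?thesis by auto
      qed
      finally show ?thesis unfolding root .
    next
      case (child k)
      have IH: "in_child (ts ! k) c i a \<longleftrightarrow>
          (a \<in> nodes (ts ! k) \<and> c \<in> nodes (ts ! k) \<and> a < c \<and>
           (\<forall>y\<in>nodes (ts ! k). c < y \<longrightarrow> inversion_number s (ts ! k) y a = inversion_number s (ts ! k) y c)) \<and>
          inversion_number s (ts ! k) c a = i"
        using Node.IH[of "ts ! k"] child_decreasing[OF dec] child by simp
      have sub: "nodes (ts ! k) \<subseteq> nodes ?T" using child by auto
      show ?thesis unfolding in_child_child[OF dec child(1,2)]
      proof
        assume "in_child (ts ! k) c i a"
        note I = this[unfolded IH]
        have "?v y a = ?v y c" if y: "y \<in> nodes ?T" "c < y" for y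
          using dec y(1)
        proof (cases rule: node_cases)
          case root
          then show ?thesis using root at_root[of k] child I by simp
        next
          case q: (child q)
          then show ?thesis using children[of k q _ y] child I y by auto
        qed
        then show "(a \<in> nodes ?T \<and> c \<in> nodes ?T \<and> a < c \<and> (\<forall>y\<in>nodes ?T. c < y \<longrightarrow> ?v y a = ?v y c)) \<and> ?v c a = i"
          using I sub children[of k k a c] child by auto
      next
        assume R: "(a \<in> nodes ?T \<and> c \<in> nodes ?T \<and> a < c \<and> (\<forall>y\<in>nodes ?T. c < y \<longrightarrow> ?v y a = ?v y c)) \<and> ?v c a = i"
        then have "?v r a = ?v r c" using child by auto
        moreover obtain l where l: "l < length ts" "a \<in> nodes (ts ! l)"
          using in_some_child[OF dec] R by metis
        ultimately have ak: "a \<in> nodes (ts ! k)" using at_root child by auto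
        show "in_child (ts ! k) c i a" unfolding IH
        proof (intro conjI ballI impI)
          fix y assume y: "y \<in> nodes (ts ! k)" "c < y"
          then have "?v y a = ?v y c" using R sub by blast
          then show "inversion_number s (ts ! k) y a = inversion_number s (ts ! k) y c"
            using children[of k k a y] children[of k k c y] child ak y by simp
        qed (use R child ak children[of k k a c] in auto)
      qed
    qed
  qed
qed

lemma is_child_Leaf_imp_empty:
  assumes "decreasing s T" "is_child T c i Leaf"
  shows "\<not> in_child T c i a"
  using assms
proof (induction T)
  case Leaf
  then show ?case by (simp add: is_child_def)
next
  case (Node r ts)
  note dec = Node.prems(1)
  show ?case
  proof (cases "\<exists>k<length ts. is_child (ts ! k) c i Leaf")
    case True
    then obtain k where k: "k < length ts" "is_child (ts ! k) c i Leaf" by blast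
    then have "c \<in> nodes (ts ! k)" using subtrees_nodes by (auto simp: is_child_def)
    then show ?thesis
      using in_child_child[OF dec k(1)] Node.IH[of "ts ! k"] child_decreasing[OF dec] k by simp
  next
    case False
    then have "c = r \<and> i < length ts \<and> ts ! i = Leaf"
      using Node.prems(2) by (auto simp: is_child_def in_set_conv_nth)
    then show ?thesis by (auto simp: in_child_root[OF dec])
  qed
qed

text \<open>
  Tree-ascents are ascents of the inversion function. Only this inclusion is needed, since
  ascents occur as hypotheses throughout.
\<close>

lemma tree_ascents_subset:
  assumes "decreasing s T"
  shows "tree_ascents s T \<subseteq>
    inversion_function.ascents (nodes T) (part s) (inversion_number s T)"
proof -
  interpret inversion_function "nodes T" "part s" "inversion_number s T"
    by (rule inversion_function_tree[OF assms])
  note ic = in_child_iff[OF assms]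
  show ?thesis
  proof (rule subrelI)
    fix a c assume *: "(a, c) \<in> tree_ascents s T"
    have "below c a" using * by (auto simp: tree_ascents_def descendant_def ic)
    moreover have "inversion_number s T c a \<noteq> part s c"
      using * \<open>below c a\<close> by (auto simp: tree_ascents_def ic)
    moreover have "inversion_number s T c a \<le> part s c"
      using bounded \<open>below c a\<close> by (auto simp: below_def)
    moreover have "inversion_number s T b a = part s b" if "a < b" "b < c" "below b a" for b
      using * that by (auto simp: tree_ascents_def descendant_def ic)
    moreover have "inversion_number s T a d \<noteq> part s a" if "0 < part s a" "below a d" for d
      using * that is_child_Leaf_imp_empty[OF assms, of a "part s a" d] by (auto simp: tree_ascents_def ic)
    ultimately show "(a, c) \<in> ascents" by (auto simp: ascents_def)
  qed
qed

text \<open>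
  Inversion numbers determine the tree: its root is the largest label, and the \<open>i\<close>-th child of the
  root consists of the labels at which the root has inversion number \<open>i\<close>.
\<close>

lemma tree_eqI:
  assumes "decreasing s T" "decreasing s U" "nodes T = nodes U"
    and "\<And>a c. \<lbrakk>a \<in> nodes T; c \<in> nodes T; a < c\<rbrakk> \<Longrightarrow> inversion_number s T c a = inversion_number s U c a"
  shows "T = U"
  using assms
proof (induction T arbitrary: U)
  case Leaf
  then show ?case by (cases U) auto
next
  case (Node r ts)
  then obtain q us where U: "U = Node q us" by (cases U) auto
  note dec = Node.prems(1) Node.prems(2)[unfolded U]
  have "r \<in> nodes U" "q \<in> nodes (Node r ts)" using Node.prems(3) U by auto
  then have "r = q"
    unfolding U by (metis node_cases[OF dec(1)] node_cases[OF dec(2)] less_asym)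
  have len: "length us = length ts"
    using length_children[OF dec(1)] length_children[OF dec(2)] \<open>r = q\<close> by simp
  have nd: "a \<in> nodes (ts ! i) \<longleftrightarrow> a \<in> nodes (us ! i)" if i: "i < length ts" for a i
  proof -
    have "a \<in> nodes (ts ! i) \<longleftrightarrow> a \<in> nodes (Node r ts) \<and> a < r \<and> inversion_number s (Node r ts) r a = i"
      using i inversion_number_root[OF dec(1)] child_less[OF dec(1)]
      unfolding nodes_Node by blast
    also have "\<dots> \<longleftrightarrow> a \<in> nodes U \<and> a < r \<and> inversion_number s U r a = i"
    proof -
      have "inversion_number s (Node r ts) r a = inversion_number s U r a"
        if "a \<in> nodes (Node r ts)" "a < r"
        using Node.prems(4)[of a r] that by simp
      then show ?thesis unfolding Node.prems(3) by auto
    qed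
    also have "\<dots> \<longleftrightarrow> a \<in> nodes (us ! i)"
      using i inversion_number_root[OF dec(2)] child_less[OF dec(2)] len
      unfolding nodes_Node U \<open>r = q\<close> by auto
    finally show ?thesis .
  qed
  have "ts ! i = us ! i" if i: "i < length ts" for i
  proof (rule Node.IH)
    show "ts ! i \<in> set ts" using i by simp
    show "decreasing s (ts ! i)" "decreasing s (us ! i)"
      using child_decreasing[OF dec(1)] child_decreasing[OF dec(2)] i len by auto
    show "nodes (ts ! i) = nodes (us ! i)" using nd i by blast
    fix a c assume ac: "a \<in> nodes (ts ! i)" "c \<in> nodes (ts ! i)" "a < c"
    then have "a \<in> nodes (Node r ts)" "c \<in> nodes (Node r ts)" using i by auto
    then have "inversion_number s (Node r ts) c a = inversion_number s U c a"
      using Node.prems(4) ac by blast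
    then show "inversion_number s (ts ! i) c a = inversion_number s (us ! i) c a"
      using inversion_number_children[OF dec(1), of i i a c] inversion_number_children[OF dec(2), of i i a c]
        ac i len nd U by simp
  qed
  then show ?case using len \<open>r = q\<close> U by (auto intro: nth_equalityI)
qed

text \<open>
  The root is the largest label \<open>r\<close>, and its \<open>i\<close>-th child is built from the labels \<open>a\<close> with
  \<open>f r a = i\<close>. For labels in different children, transitivity and planarity at \<open>r\<close> force the
  values that the tree has.
\<close>

lemma tree_exists:
  assumes "finite X" "inversion_function X (part s) f"
  shows "\<exists>T. decreasing s T \<and> nodes T = X \<and>
    (\<forall>a\<in>X. \<forall>c\<in>X. a < c \<longrightarrow> inversion_number s T c a = f c a)"
  using assms
proof (induction X rule: finite_psubset_induct)
  case (psubset X)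
  interpret inversion_function X "part s" f by fact
  show ?case
  proof (cases "X = {}")
    case True
    then show ?thesis by (intro exI[of _ Leaf]) (simp add: decreasing_Leaf)
  next
    case False
    define r where "r = Max X"
    have r: "r \<in> X" "\<And>a. a \<in> X \<Longrightarrow> a \<le> r" using False psubset(1) by (auto simp: r_def)
    define Y where "Y i = {a \<in> X. a < r \<and> f r a = i}" for i
    have YX: "Y i \<subset> X" for i using r by (auto simp: Y_def)
    have "\<exists>T. decreasing s T \<and> nodes T = Y i \<and>
      (\<forall>a\<in>Y i. \<forall>c\<in>Y i. a < c \<longrightarrow> inversion_number s T c a = f c a)" for i
    proof (rule psubset.IH[OF YX])
      show "inversion_function (Y i) (part s) f"
        using bounded transitive planar YX[of i]
        by unfold_locales (meson psubset_imp_subset subsetD)+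
    qed
    then obtain t where t: "\<And>i. decreasing s (t i)" "\<And>i. nodes (t i) = Y i"
      "\<And>i a c. \<lbrakk>a \<in> Y i; c \<in> Y i; a < c\<rbrakk> \<Longrightarrow> inversion_number s (t i) c a = f c a"
      by metis
    define ts where "ts = map t [0..<part s r + 1]"
    have len: "length ts = part s r + 1" by (simp add: ts_def)
    have nth: "ts ! i = t i" if "i < part s r + 1" for i
      using that by (simp add: ts_def del: upt_Suc)
    have dec: "decreasing s (Node r ts)"
      unfolding decreasing_Node len
      by (auto simp: nth t Y_def ts_def simp del: upt_Suc)
    have pos: "f r a < length ts \<and> a \<in> nodes (ts ! f r a)" if "a \<in> X" "a < r" for a
      using bounded[of a r] that r by (simp add: len nth t Y_def)
    have "nodes (Node r ts) = insert r (\<Union>i<part s r + 1. Y i)"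
      by (auto simp: ts_def t simp del: upt_Suc)
    also have "\<dots> = X"
    proof -
      have "a \<in> (\<Union>i<part s r + 1. Y i)" if "a \<in> X" "a \<noteq> r" for a
        using pos[of a] r(2)[of a] that by (auto simp: len Y_def)
      moreover have "(\<Union>i<part s r + 1. Y i) \<subseteq> X" using YX by blast
      ultimately show ?thesis using r(1) by blast
    qed
    finally have nodes: "nodes (Node r ts) = X" .
    have "inversion_number s (Node r ts) c a = f c a" if ac: "a \<in> X" "c \<in> X" "a < c" for a c
    proof (cases "c = r")
      case True
      then show ?thesis using inversion_number_root[OF dec, of "f r a" a] pos[of a] ac by simp
    next
      case False
      then have cr: "c < r" "a < r" using r(2)[of c] ac by auto
      have "f c a = 0" if "f r a < f r c"
        using transitive[of a c r] ac cr r that by auto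
      moreover have "f c a = part s c" if "f r c < f r a"
        using planar[of a c r] ac cr r that by auto
      moreover have "inversion_number s (ts ! f r c) c a = f c a" if "f r c = f r a"
      proof -
        have "a \<in> Y (f r c)" "c \<in> Y (f r c)" using ac cr that by (auto simp: Y_def)
        then show ?thesis using t(3) ac pos[of c] cr by (simp add: nth len)
      qed
      ultimately show ?thesis
        using inversion_number_children[OF dec, of "f r a" "f r c" a c] pos[of a] pos[of c] ac cr
        by auto
    qed
    then show ?thesis using dec nodes by blast
  qed
qed

section \<open>Pure intervals\<close>

lemma s_decreasing_tree_eqI:
  assumes "s_decreasing_tree s T" "s_decreasing_tree s U"
    and "\<And>a c. \<lbrakk>1 \<le> a; a < c; c \<le> length s\<rbrakk> \<Longrightarrow> inversion_number s T c a = inversion_number s U c a"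
  shows "T = U"
  using assms by (intro tree_eqI) (auto simp: s_decreasing_tree_iff)

text \<open>
  A tree is determined by finitely many bounded inversion numbers.
\<close>

lemma finite_s_decreasing_trees: "finite {T. s_decreasing_tree s T}"
proof -
  let ?P = "{(c, a). a \<in> {1..length s} \<and> c \<in> {1..length s} \<and> a < c}"
  let ?h = "\<lambda>T. restrict (\<lambda>(c, a). inversion_number s T c a) ?P"
  have "inversion_number s T c a \<le> part s c"
    if "s_decreasing_tree s T" "(c, a) \<in> ?P" for T c a
    using that inversion_function.bounded[OF inversion_function_tree, of s T a c]
    by (auto simp: s_decreasing_tree_iff)
  then have "?h ` {T. s_decreasing_tree s T} \<subseteq> (\<Pi>\<^sub>E (c, a)\<in>?P. {..part s c})"
    by (intro image_subsetI PiE_I) auto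
  moreover have "finite ?P"
    by (rule finite_subset[of _ "{1..length s} \<times> {1..length s}"]) auto
  then have "finite (\<Pi>\<^sub>E (c, a)\<in>?P. {..part s c})"
    by (auto intro: finite_PiE)
  ultimately have "finite (?h ` {T. s_decreasing_tree s T})"
    by (rule finite_subset)
  moreover have "inj_on ?h {T. s_decreasing_tree s T}"
  proof (rule inj_onI)
    fix T U
    assume *: "T \<in> {T. s_decreasing_tree s T}" "U \<in> {T. s_decreasing_tree s T}" and eq: "?h T = ?h U"
    have "inversion_number s T c a = inversion_number s U c a"
      if "1 \<le> a" "a < c" "c \<le> length s" for a c
      using fun_cong[OF eq, of "(c, a)"] that by simp
    then show "T = U" using * by (auto intro: s_decreasing_tree_eqI)
  qed
  ultimately show ?thesis by (rule finite_imageD)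
qed

lemma s_weak_le_refl: "s_weak_le s T T"
  by (simp add: s_weak_le_def)

lemma s_weak_le_antisym:
  assumes "s_decreasing_tree s T" "s_decreasing_tree s U" "s_weak_le s T U" "s_weak_le s U T"
  shows "T = U"
  using assms by (intro s_decreasing_tree_eqI) (auto simp: s_weak_le_def intro: antisym)

lemma finite_tree_ascents: "finite (tree_ascents s T)"
proof (rule finite_subset)
  show "tree_ascents s T \<subseteq> nodes T \<times> nodes T"
    by (auto simp: tree_ascents_def descendant_def dest: in_child_nodes)
qed simp

text \<open>
  The multiset \<open>inv(T) + A\<close> before taking the transitive closure.
\<close>

abbreviation raised_inversions :: "weak_composition \<Rightarrow> ptree \<Rightarrow> (nat \<times> nat) set \<Rightarrow> (nat \<times> nat) multiset" where
  "raised_inversions s T A \<equiv> tree_inversions s T + mset_set (prod.swap ` A)"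

context
  fixes s :: weak_composition and T :: ptree and A :: "(nat \<times> nat) set"
  assumes T: "s_decreasing_tree s T" and A: "A \<subseteq> tree_ascents s T"
begin

lemma raised_inversion_function_tree:
  "raised_inversion_function (nodes T) (part s) (inversion_number s T) A (raised_inversions s T A)"
proof -
  have dec: "decreasing s T" using T by (simp add: s_decreasing_tree_iff)
  interpret inversion_function "nodes T" "part s" "inversion_number s T"
    by (rule inversion_function_tree[OF dec])
  have asc: "A \<subseteq> ascents" using A tree_ascents_subset[OF dec] by blast
  have "finite A" using A finite_tree_ascents finite_subset by blast
  moreover have "(c, a) \<in> prod.swap ` A \<longleftrightarrow> (a, c) \<in> A" for a c by force
  ultimately have "count (mset_set (prod.swap ` A)) (c, a) = of_bool ((a, c) \<in> A)" for a c
    by (simp add: count_mset_set')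
  moreover have "a \<in> nodes T \<and> c \<in> nodes T \<and> a < c" if "(a, c) \<in> A" for a c
    using ascentsD[of a c] asc that by blast
  ultimately show ?thesis
    by unfold_locales (use asc in \<open>auto simp: count_tree_inversions\<close>)
qed

text \<open>
  The description that defines \<open>T + A\<close> is satisfied by exactly one tree.
\<close>

lemma tree_plus_spec:
  "s_decreasing_tree s (tree_plus s T A) \<and>
   tree_inversions s (tree_plus s T A) = tc (raised_inversions s T A)"
proof -
  interpret raised_inversion_function "nodes T" "part s" "inversion_number s T" A "raised_inversions s T A"
    by (rule raised_inversion_function_tree)
  have N: "nodes T = {1..length s}" using T by (simp add: s_decreasing_tree_iff)
  obtain U where U: "decreasing s U" "nodes U = nodes T"
    "\<forall>a\<in>nodes T. \<forall>c\<in>nodes T. a < c \<longrightarrow>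
      inversion_number s U c a = count (tc (raised_inversions s T A)) (c, a)"
    using tree_exists[OF fin tc_inversion_function] by blast
  have "tree_inversions s U = tc (raised_inversions s T A)"
  proof (rule multiset_eqI, clarify)
    fix c a
    show "count (tree_inversions s U) (c, a) = count (tc (raised_inversions s T A)) (c, a)"
      using U count_tc_outside[of a c] by (auto simp: count_tree_inversions)
  qed
  then have U': "s_decreasing_tree s U \<and> tree_inversions s U = tc (raised_inversions s T A)"
    using U(1,2) N by (simp add: s_decreasing_tree_iff)
  show ?thesis
    unfolding tree_plus_def
  proof (rule theI[of _ U])
    fix V assume V: "s_decreasing_tree s V \<and> tree_inversions s V = tc (raised_inversions s T A)"
    show "V = U"
    proof (rule s_decreasing_tree_eqI)
      fix a c assume "1 \<le> a" "a < c" "c \<le> length s"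
      then show "inversion_number s V c a = inversion_number s U c a"
        using V U' count_tree_inversions[of s V c a] count_tree_inversions[of s U c a]
        by (simp add: s_decreasing_tree_iff)
    qed (use V U' in auto)
  qed (rule U')
qed

lemma s_decreasing_tree_plus: "s_decreasing_tree s (tree_plus s T A)"
  using tree_plus_spec by blast

lemma inversion_number_tree_plus:
  assumes "1 \<le> a" "a < c" "c \<le> length s"
  shows "inversion_number s (tree_plus s T A) c a = count (tc (raised_inversions s T A)) (c, a)"
  using tree_plus_spec count_tree_inversions[of s "tree_plus s T A" c a] assms
  by (simp add: s_decreasing_tree_iff)

lemma tree_le_tree_plus: "s_weak_le s T (tree_plus s T A)"
  unfolding s_weak_le_def
proof (intro allI impI, elim conjE)
  interpret raised_inversion_function "nodes T" "part s" "inversion_number s T" A "raised_inversions s T A"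
    by (rule raised_inversion_function_tree)
  fix a c assume ac: "1 \<le> a" "a < c" "c \<le> length s"
  then have "inversion_number s T c a \<le> count (raised_inversions s T A) (c, a)"
    using T by (intro f_le_count_I) (auto simp: s_decreasing_tree_iff)
  also have "\<dots> \<le> inversion_number s (tree_plus s T A) c a"
    using count_I_le_count_tc inversion_number_tree_plus[OF ac] by simp
  finally show "inversion_number s T c a \<le> inversion_number s (tree_plus s T A) c a" .
qed

lemma ascent_in_iff:
  assumes "(a, c) \<in> tree_ascents s T"
  shows "(a, c) \<in> A \<longleftrightarrow> inversion_number s T c a < inversion_number s (tree_plus s T A) c a"
proof -
  interpret raised_inversion_function "nodes T" "part s" "inversion_number s T" A "raised_inversions s T A"
    by (rule raised_inversion_function_tree)
  have asc: "(a, c) \<in> ascents"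
    using tree_ascents_subset assms T unfolding s_decreasing_tree_iff by blast
  then have ac: "a \<in> nodes T" "c \<in> nodes T" "a < c" by (auto dest: ascentsD)
  then have eq: "inversion_number s (tree_plus s T A) c a = count (tc (raised_inversions s T A)) (c, a)"
    using inversion_number_tree_plus T by (auto simp: s_decreasing_tree_iff)
  show ?thesis
  proof
    assume "(a, c) \<in> A"
    then have "inversion_number s T c a < count (raised_inversions s T A) (c, a)"
      using ac by (subst count_I) simp
    then show "inversion_number s T c a < inversion_number s (tree_plus s T A) c a"
      unfolding eq using count_I_le_count_tc less_le_trans by blast
  next
    assume "inversion_number s T c a < inversion_number s (tree_plus s T A) c a"
    then show "(a, c) \<in> A" using count_tc_ascent[OF asc] unfolding eq by linarith
  qed
qed

lemma ends_in_interval: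
  "T \<in> s_weak_interval s T (tree_plus s T A)"
  "tree_plus s T A \<in> s_weak_interval s T (tree_plus s T A)"
  using T s_decreasing_tree_plus tree_le_tree_plus by (auto simp: s_weak_interval_def s_weak_le_refl)

end

lemma pure_interval_inj:
  assumes T: "s_decreasing_tree s T" "A \<subseteq> tree_ascents s T"
    and U: "s_decreasing_tree s U" "B \<subseteq> tree_ascents s U"
    and eq: "s_weak_interval s T (tree_plus s T A) = s_weak_interval s U (tree_plus s U B)"
  shows "T = U \<and> A = B"
proof -
  have "T = U"
    using ends_in_interval(1)[OF T] ends_in_interval(1)[OF U] eq T U
    by (auto simp: s_weak_interval_def intro: s_weak_le_antisym)
  moreover have "tree_plus s T A = tree_plus s U B"
    using ends_in_interval(2)[OF T] ends_in_interval(2)[OF U] eq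
    by (auto simp: s_weak_interval_def intro: s_weak_le_antisym)
  ultimately have "(a, c) \<in> A \<longleftrightarrow> (a, c) \<in> B" for a c
    using ascent_in_iff[OF T] ascent_in_iff[OF U] T(2) U(2) by (metis subsetD)
  then show ?thesis using \<open>T = U\<close> by auto
qed

lemma face_dim_pure_interval:
  assumes "s_decreasing_tree s T" "A \<subseteq> tree_ascents s T"
  shows "face_dim s (s_weak_interval s T (tree_plus s T A)) = card A"
  unfolding face_dim_def using pure_interval_inj assms by (intro the_equality) blast+

section \<open>The f-polynomial\<close>

lemma sum_monom_card_Pow:
  assumes "finite A"
  shows "(\<Sum>B\<in>Pow A. monom 1 (card B)) = [:1, 1 :: 'a :: comm_semiring_1:] ^ card A"
proof -
  have "[:1, 1:] ^ card A = (\<Prod>a\<in>A. monom (1 :: 'a) 1 + 1)"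
    by (simp add: monom_altdef one_pCons)
  also have "\<dots> = (\<Sum>B\<in>Pow A. (\<Prod>a\<in>B. monom 1 1) * (\<Prod>a\<in>A - B. 1))"
    by (rule prod_add[OF assms])
  also have "\<dots> = (\<Sum>B\<in>Pow A. monom 1 (card B))"
    by (simp add: monom_power)
  finally show ?thesis by simp
qed

theorem proposition2p4:
  fixes s :: weak_composition
  shows "f_polynomial s = (\<Sum>T | s_decreasing_tree s T. [:1, 1:] ^ asc s T)"
proof -
  let ?D = "SIGMA T:{T. s_decreasing_tree s T}. Pow (tree_ascents s T)"
  let ?F = "\<lambda>(T, A). s_weak_interval s T (tree_plus s T A)"
  have "Perm s = ?F ` ?D" by (auto simp: Perm_def)
  moreover have "inj_on ?F ?D"
    by (rule inj_onI) (auto dest: pure_interval_inj[rotated 4])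
  ultimately have "f_polynomial s = (\<Sum>p\<in>?D. monom 1 (face_dim s (?F p)))"
    by (simp add: f_polynomial_def sum.reindex)
  also have "\<dots> = (\<Sum>(T, A)\<in>?D. monom 1 (card A))"
    by (rule sum.cong) (auto simp: face_dim_pure_interval)
  also have "\<dots> = (\<Sum>T | s_decreasing_tree s T. \<Sum>A\<in>Pow (tree_ascents s T). monom 1 (card A))"
    by (rule sum.Sigma[symmetric]) (auto simp: finite_s_decreasing_trees finite_tree_ascents)
  also have "\<dots> = (\<Sum>T | s_decreasing_tree s T. [:1, 1:] ^ asc s T)"
    by (simp add: sum_monom_card_Pow finite_tree_ascents asc_def)
  finally show ?thesis .
qed

end
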